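(* Let $G$ be a finite directed acyclic graph with a unique source $s$ and a unique sink $t$, with no idle edges, satisfying degree equality, and let $(\mathcal{R},\leq)$ be a route decomposition $\mathcal{R}=\{R_1<\cdots<R_k\}$ of $G$ with a linear ordering. Then a collection $C$ of routes of $G$ is (the vertex set of) a simplex in $T_{\mathrm{eq}}$ if and only if the following two conditions hold: (1) the routes in $C$ form a clique with respect to the route decomposition framing induced by $\leq$ on $\mathcal{R}$ (that is, they form a simplex of the DKK triangulation induced by this framing); (2) the routes in $C$ avoid a transversal, i.e. there are edges $e_1\in R_1,\dots,e_k\in R_k$ such that no route in $C$ uses any of $e_1,\dots,e_k$.
   Context: Directed graphs may have parallel edges. The vertices of $G$ are ordered $s<1<\cdots<n<t$ with every edge $(i,j)$ satisfying $i<j$; $1,\dots,n$ are the inner vertices. An edge is idle if it is the only incoming or the only outgoing edge of some inner vertex. A route is a directed path from $s$ to $t$ (a sequence of edges); $\chi_R\in\mathbb{R}^{E(G)}$ is the indicator vector of a route $R$. The flow polytope $\mathcal{F}_1(G)$ is the set of $x\in\mathbb{R}_{\ge 0}^{E(G)}$ with inflow equal to outflow at every inner vertex and total outflow $1$ at $s$; its vertices are the vectors $\chi_R$. Degree equality: $\mathrm{indeg}_G(v)=\mathrm{outdeg}_G(v)$ for all inner $v$. A route decomposition is a set $\mathcal{R}$ of routes whose edge sets partition $E(G)$. A transversal of $\mathcal{R}$ is a set of edges consisting of exactly one edge from each route of $\mathcal{R}$. Framings and DKK triangulations. A framing is a choice, for each inner vertex $v$, of linear orders on the set $\mathrm{in}(v)$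 of incoming edges and the set $\mathrm{out}(v)$ of outgoing edges. For a route $P$ through $v$, $Pv$ is the part of $P$ from $s$ to $v$ and $vP$ the part from $v$ to $t$. For two distinct directed paths $P,Q$ from $v$ to $t$, let $w$ be the last vertex of their common initial segment starting at $v$; then $P\prec_{\mathrm{Out}(v)}Q$ if the edge of $P$ leaving $w$ is smaller in $\mathrm{out}(w)$ than the edge of $Q$ leaving $w$. Symmetrically, for two distinct directed paths $P,Q$ from $s$ to $v$, let $w$ be the first vertex of their common final segment ending at $v$; then $P\prec_{\mathrm{In}(v)}Q$ if the edge of $P$ entering $w$ is smaller in $\mathrm{in}(w)$ than the edge of $Q$ entering $w$. Two routes $P,Q$ sharing an inner vertex $v$ are in conflict at $v$ if (up to exchanging $P$ and $Q$) $Pv\prec_{\mathrm{In}(v)}Qv$ and $vQ\prec_{\mathrm{Out}(v)}vP$. Two routes are coherent if they are not in conflict at any common inner vertex. A clique is a set of pairwise coherent routes. The DKK triangulation of $\mathcal{F}_1(G)$ induced by a framing is the triangulation whose simplices are the convex hulls of $\{\chi_R: R\in C\}$ for cliques $C$ (it is a regular unimodular triangulation by a theorem of Danilov, Karzanov and Koshevoy). Route decomposition framing. Given $\mathcal{R}=\{R_1<\cdots<R_k\}$, every edge lies in exactly one $R_i$; at each inner vertex order the incoming edges, and likewise the outgoing edges, by the order of the routes of $\mathcal{R}$ containing them. Let $T$ be the DKK triangulation induced by this framing. Equatorial complex. $\Gamma$ is the polyhedral subcomplex of $\partial\mathcal{F}_1(G)$ generated by all faces of the form $\bigcap_{R\in\mathcal{R}}F_R$,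 where each $F_R$ is a facet of $\mathcal{F}_1(G)$ with $\chi_R\notin F_R$. $T_{\mathrm{eq}}:=T|_\Gamma$ is the restriction of $T$ to $\Gamma$, i.e. the subcomplex of simplices of $T$ contained in a face of $\Gamma$. *)

theory Defs
  imports "HOL-Analysis.Analysis" "HOL-Library.Disjoint_Sets" "Graph_Theory.Arc_Walk"
begin

section \<open>Directed acyclic graphs with one source and one sink\<close>

text \<open>Digraphs are those of the Graph Theory entry, hence may have parallel arcs. A vertex is a
  source if its in-degree is 0 and a sink if its out-degree is 0. The labelling
  \<open>s < 1 < ... < n < t\<close> of the vertices is a topological ordering; nothing below depends on which
  one is chosen, so only acyclicity is recorded.\<close>

locale st_dag = fin_digraph G
  for G :: "('v, 'e) pre_digraph" and s t :: 'v +
  assumes acyclic_arcs: "acyclic (arcs_ends G)"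
    and unique_source: "{v \<in> verts G. in_degree G v = 0} = {s}"
    and unique_sink: "{v \<in> verts G. out_degree G v = 0} = {t}"
    and source_neq_sink: "s \<noteq> t"

definition inner_verts :: "('v, 'e) pre_digraph \<Rightarrow> 'v \<Rightarrow> 'v \<Rightarrow> 'v set" where
  "inner_verts G s t = verts G - {s, t}"

definition idle :: "('v, 'e) pre_digraph \<Rightarrow> 'v \<Rightarrow> 'v \<Rightarrow> 'e \<Rightarrow> bool" where
  "idle G s t e \<longleftrightarrow> (\<exists>v \<in> inner_verts G s t. in_arcs G v = {e} \<or> out_arcs G v = {e})"

definition degree_equality :: "('v, 'e) pre_digraph \<Rightarrow> 'v \<Rightarrow> 'v \<Rightarrow> bool" where
  "degree_equality G s t \<longleftrightarrow> (\<forall>v \<in> inner_verts G s t. in_degree G v = out_degree G v)"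

definition routes :: "('v, 'e) pre_digraph \<Rightarrow> 'v \<Rightarrow> 'v \<Rightarrow> 'e awalk set" where
  "routes G s t = {R. pre_digraph.apath G s R t}"

section \<open>The flow polytope\<close>

definition route_vec :: "'e::finite awalk \<Rightarrow> real ^ 'e" where
  "route_vec R = (\<chi> e. if e \<in> set R then 1 else 0)"

text \<open>The ambient space \<open>\<real>\<^sup>E\<close> is \<open>real ^ 'e\<close>, so this is meant for graphs with \<open>arcs G = UNIV\<close>.\<close>

definition flow_polytope :: "('v, 'e::finite) pre_digraph \<Rightarrow> 'v \<Rightarrow> 'v \<Rightarrow> (real ^ 'e) set" where
  "flow_polytope G s t = {x. (\<forall>e. 0 \<le> x $ e)
     \<and> (\<forall>v \<in> inner_verts G s t. (\<Sum>e \<in> in_arcs G v. x $ e) = (\<Sum>e \<in> out_arcs G v. x $ e))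
     \<and> (\<Sum>e \<in> out_arcs G s. x $ e) = 1}"

text \<open>Unlike \<^const>\<open>facet_of\<close>, this counts the empty set (of dimension \<open>-1\<close>) as the facet of a
  point; the two notions agree for every other polytope. A point arises as the flow polytope of a
  single arc.\<close>

definition facet_in :: "'a::euclidean_space set \<Rightarrow> 'a set \<Rightarrow> bool" where
  "facet_in F P \<longleftrightarrow> F face_of P \<and> aff_dim F = aff_dim P - 1"

section \<open>Route decompositions and framings\<close>

definition route_decomposition ::
    "('v, 'e) pre_digraph \<Rightarrow> 'v \<Rightarrow> 'v \<Rightarrow> 'e awalk set \<Rightarrow> bool" where
  "route_decomposition G s t \<R> \<longleftrightarrow>
     \<R> \<subseteq> routes G s t \<and> disjoint_family_on set \<R> \<and> (\<Union>R \<in> \<R>. set R) = arcs G"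

definition transversal :: "'e awalk set \<Rightarrow> 'e set \<Rightarrow> bool" where
  "transversal \<R> U \<longleftrightarrow> U \<subseteq> (\<Union>R \<in> \<R>. set R) \<and> (\<forall>R \<in> \<R>. \<exists>!e. e \<in> U \<and> e \<in> set R)"

text \<open>Linear orders are reflexive relations, as in \<^const>\<open>linear_order_on\<close>.\<close>

record ('v, 'e) framing =
  in_ord :: "'v \<Rightarrow> 'e rel"
  out_ord :: "'v \<Rightarrow> 'e rel"

definition is_framing ::
    "('v, 'e) pre_digraph \<Rightarrow> 'v \<Rightarrow> 'v \<Rightarrow> ('v, 'e) framing \<Rightarrow> bool" where
  "is_framing G s t \<F> \<longleftrightarrow> (\<forall>v \<in> inner_verts G s t.
     linear_order_on (in_arcs G v) (in_ord \<F> v) \<and> linear_order_on (out_arcs G v) (out_ord \<F> v))"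

definition arc_ord :: "'e awalk set \<Rightarrow> 'e awalk rel \<Rightarrow> 'e set \<Rightarrow> 'e rel" where
  "arc_ord \<R> r A = {(e, f) \<in> A \<times> A. \<exists>R \<in> \<R>. \<exists>R' \<in> \<R>. e \<in> set R \<and> f \<in> set R' \<and> (R, R') \<in> r}"

definition route_framing ::
    "('v, 'e) pre_digraph \<Rightarrow> 'e awalk set \<Rightarrow> 'e awalk rel \<Rightarrow> ('v, 'e) framing" where
  "route_framing G \<R> r =
     \<lparr>in_ord = (\<lambda>v. arc_ord \<R> r (in_arcs G v)), out_ord = (\<lambda>v. arc_ord \<R> r (out_arcs G v))\<rparr>"

lemma (in st_dag) is_framing_route_framing:
  assumes dec: "route_decomposition G s t \<R>" and lin: "linear_order_on \<R> r"
  shows "is_framing G s t (route_framing G \<R> r)"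
proof -
  have lin_arc: "linear_order_on A (arc_ord \<R> r A)"
    if A: "A \<subseteq> arcs G"
      and one: "\<And>R e f. R \<in> \<R> \<Longrightarrow> e \<in> A \<Longrightarrow> f \<in> A \<Longrightarrow> e \<in> set R \<Longrightarrow> f \<in> set R \<Longrightarrow> e = f" for A
  proof -
    have ex: "\<exists>R \<in> \<R>. e \<in> set R" if "e \<in> A" for e
      using that A dec unfolding route_decomposition_def by blast
    have uniq: "R = R'" if "R \<in> \<R>" "R' \<in> \<R>" "e \<in> set R" "e \<in> set R'" for R R' e
      using that dec unfolding route_decomposition_def disjoint_family_on_def by blast
    have rr: "(R, R) \<in> r" if "R \<in> \<R>" for R
      using lin that unfolding order_on_defs refl_on_def by blast
    have tot: "(R, R') \<in> r \<or> (R', R) \<in> r" if "R \<in> \<R>" "R' \<in> \<R>" for R R'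
      using lin that rr unfolding order_on_defs total_on_def by metis
    have as: "R = R'" if "(R, R') \<in> r" "(R', R) \<in> r" for R R'
      using lin that unfolding order_on_defs antisym_def by blast
    have tr: "(R, R'') \<in> r" if "(R, R') \<in> r" "(R', R'') \<in> r" for R R' R''
      using lin that unfolding order_on_defs trans_def by blast
    show ?thesis
      unfolding order_on_defs
    proof (intro conjI)
      show "arc_ord \<R> r A \<subseteq> A \<times> A"
        by (auto simp: arc_ord_def)
      show "refl_on A (arc_ord \<R> r A)"
        using ex rr by (fastforce simp: refl_on_def arc_ord_def)
      show "trans (arc_ord \<R> r A)"
        unfolding trans_def arc_ord_def using uniq tr by (auto; metis)
      show "antisym (arc_ord \<R> r A)"
        unfolding antisym_def arc_ord_def using uniq as one by (auto; metis)
      show "total_on A (arc_ord \<R> r A)"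
        unfolding total_on_def arc_ord_def using ex tot by (auto; metis)
    qed
  qed
  have path: "apath s R t" if "R \<in> \<R>" for R
    using that dec by (auto simp: route_decomposition_def routes_def)
  have heads: "distinct (map (head G) p)" "distinct (map (tail G) p)" if "apath u p w" for u p w
  proof -
    from that have d: "distinct (awalk_verts u p)" and c: "cas u p w"
      by (auto simp: apath_def awalk_def)
    from c have "awalk_verts u p = u # map (head G) p"
      by (induction u p w rule: cas.induct) auto
    with d show "distinct (map (head G) p)" by simp
    from c have "awalk_verts u p = map (tail G) p @ [w]"
      by (induction u p w rule: cas.induct) auto
    with d show "distinct (map (tail G) p)" by simp
  qed
  have "linear_order_on (in_arcs G v) (arc_ord \<R> r (in_arcs G v))" for v
    by (rule lin_arc) (use path heads(1) in \<open>auto simp: distinct_map in_arcs_def dest!: inj_onD\<close>)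
  moreover have "linear_order_on (out_arcs G v) (arc_ord \<R> r (out_arcs G v))" for v
    by (rule lin_arc) (use path heads(2) in \<open>auto simp: distinct_map out_arcs_def dest!: inj_onD\<close>)
  ultimately show ?thesis
    by (simp add: is_framing_def route_framing_def)
qed

section \<open>The DKK triangulation\<close>

text \<open>Two distinct directed paths with the same end points split for the first time, along
  different arcs \<open>e\<close>, \<open>f\<close>, right after their common initial segment \<open>c\<close>, that is at \<open>tail G e\<close>.
  Dually, \<open>c\<close> is the common final segment in \<open>in_less\<close>.\<close>

definition out_less ::
    "('v, 'e) pre_digraph \<Rightarrow> ('v, 'e) framing \<Rightarrow> 'e awalk \<Rightarrow> 'e awalk \<Rightarrow> bool" where
  "out_less G \<F> p q \<longleftrightarrow> (\<exists>c e f p' q'. p = c @ e # p' \<and> q = c @ f # q' \<and> e \<noteq> f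
     \<and> (e, f) \<in> out_ord \<F> (tail G e))"

definition in_less ::
    "('v, 'e) pre_digraph \<Rightarrow> ('v, 'e) framing \<Rightarrow> 'e awalk \<Rightarrow> 'e awalk \<Rightarrow> bool" where
  "in_less G \<F> p q \<longleftrightarrow> (\<exists>c e f p' q'. p = p' @ e # c \<and> q = q' @ f # c \<and> e \<noteq> f
     \<and> (e, f) \<in> in_ord \<F> (head G e))"

text \<open>\<open>splits_at G s t v P P1 P2\<close>: \<open>P\<close> passes through \<open>v\<close>, and \<open>P1\<close>, \<open>P2\<close> are its parts from
  \<open>s\<close> to \<open>v\<close> and from \<open>v\<close> to \<open>t\<close>.\<close>

definition splits_at ::
    "('v, 'e) pre_digraph \<Rightarrow> 'v \<Rightarrow> 'v \<Rightarrow> 'v \<Rightarrow> 'e awalk \<Rightarrow> 'e awalk \<Rightarrow> 'e awalk \<Rightarrow> bool" where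
  "splits_at G s t v P P1 P2 \<longleftrightarrow>
     P = P1 @ P2 \<and> pre_digraph.apath G s P1 v \<and> pre_digraph.apath G v P2 t"

definition conflict_at ::
    "('v, 'e) pre_digraph \<Rightarrow> 'v \<Rightarrow> 'v \<Rightarrow> ('v, 'e) framing \<Rightarrow> 'v \<Rightarrow> 'e awalk \<Rightarrow> 'e awalk \<Rightarrow> bool" where
  "conflict_at G s t \<F> v P Q \<longleftrightarrow> (\<exists>P1 P2 Q1 Q2.
     splits_at G s t v P P1 P2 \<and> splits_at G s t v Q Q1 Q2 \<and>
     (in_less G \<F> P1 Q1 \<and> out_less G \<F> Q2 P2 \<or> in_less G \<F> Q1 P1 \<and> out_less G \<F> P2 Q2))"

definition coherent ::
    "('v, 'e) pre_digraph \<Rightarrow> 'v \<Rightarrow> 'v \<Rightarrow> ('v, 'e) framing \<Rightarrow> 'e awalk \<Rightarrow> 'e awalk \<Rightarrow> bool" where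
  "coherent G s t \<F> P Q \<longleftrightarrow> (\<forall>v \<in> inner_verts G s t. \<not> conflict_at G s t \<F> v P Q)"

definition is_clique ::
    "('v, 'e) pre_digraph \<Rightarrow> 'v \<Rightarrow> 'v \<Rightarrow> ('v, 'e) framing \<Rightarrow> 'e awalk set \<Rightarrow> bool" where
  "is_clique G s t \<F> C \<longleftrightarrow> C \<subseteq> routes G s t \<and> pairwise (coherent G s t \<F>) C"

definition dkk_triangulation ::
    "('v, 'e::finite) pre_digraph \<Rightarrow> 'v \<Rightarrow> 'v \<Rightarrow> ('v, 'e) framing \<Rightarrow> (real ^ 'e) set set" where
  "dkk_triangulation G s t \<F> = {convex hull (route_vec ` C) | C. is_clique G s t \<F> C}"

section \<open>The equatorial complex\<close>

text \<open>Complexes are sets of faces, and the empty face belongs to every nonempty complex.\<close>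

definition equatorial_complex ::
    "('v, 'e::finite) pre_digraph \<Rightarrow> 'v \<Rightarrow> 'v \<Rightarrow> 'e awalk set \<Rightarrow> (real ^ 'e) set set" where
  "equatorial_complex G s t \<R> = {H. \<exists>F.
     (\<forall>R \<in> \<R>. facet_in (F R) (flow_polytope G s t) \<and> route_vec R \<notin> F R) \<and>
     H face_of (\<Inter>R \<in> \<R>. F R)}"

definition restrict_complex :: "'a set set \<Rightarrow> 'a set set \<Rightarrow> 'a set set" where
  "restrict_complex T \<Gamma> = {\<sigma> \<in> T. \<exists>F \<in> \<Gamma>. \<sigma> \<subseteq> F}"

definition equatorial_triangulation ::
    "('v, 'e::finite) pre_digraph \<Rightarrow> 'v \<Rightarrow> 'v \<Rightarrow> 'e awalk set \<Rightarrow> 'e awalk rel \<Rightarrow> (real ^ 'e) set set" where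
  "equatorial_triangulation G s t \<R> r =
     restrict_complex (dkk_triangulation G s t (route_framing G \<R> r)) (equatorial_complex G s t \<R>)"

end

theory Submission
  imports Defs
begin

text \<open>
  The extreme points of the convex hull of a set of 0/1-vectors are exactly these vectors, and a route
  is determined by its indicator vector. So the claim reduces to: all routes of a clique \<open>C\<close> lie on
  facets \<open>F\<^sub>R\<close> missing \<open>\<chi>\<^sub>R\<close>, one for each \<open>R \<in> \<R>\<close>, iff \<open>C\<close> avoids a transversal.

  If a face \<open>F\<close> misses \<open>\<chi>\<^sub>R\<close>, then some arc \<open>e\<close> of \<open>R\<close> vanishes on \<open>F\<close>: otherwise averaging gives a point
  of \<open>F\<close> that is positive on all of \<open>R\<close>, hence lies on an open segment of the polytope starting at
  \<open>\<chi>\<^sub>R\<close>. Conversely, every arc \<open>e\<close> defines a facet \<open>x\<^sub>e = 0\<close>: as no arc is idle, every other arc lies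
  on a route avoiding \<open>e\<close>, so this face has a point positive on all other arcs; adding one
  route through \<open>e\<close> to the face then affinely spans the whole polytope.
\<close>

section \<open>Points with many positive coordinates\<close>

text \<open>Coordinates on \<open>F\<close> are nonnegative, so the midpoint of two points is
  positive wherever one of them is; induction on the finite set \<open>A\<close> merges the given
  points.\<close>

lemma convex_ex_positive_on:
  fixes F :: "(real ^ 'e::finite) set"
  assumes "convex F" "F \<noteq> {}" "\<And>x e. x \<in> F \<Longrightarrow> 0 \<le> x $ e"
    and "\<And>e. e \<in> A \<Longrightarrow> \<exists>x \<in> F. 0 < x $ e"
  shows "\<exists>x \<in> F. \<forall>e \<in> A. 0 < x $ e"
proof -
  have "finite A" by simp
  from this assms(4) show ?thesis
  proof (induction A)
    case empty
    then show ?case using assms(2) by blast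
  next
    case (insert a A)
    then obtain x y where x: "x \<in> F" "\<forall>e \<in> A. 0 < x $ e" and y: "y \<in> F" "0 < y $ a"
      by (metis insertCI)
    have "(1/2) *\<^sub>R x + (1/2) *\<^sub>R y \<in> F"
      using x y assms(1) by (intro convexD) auto
    moreover have "0 < ((1/2) *\<^sub>R x + (1/2) *\<^sub>R y) $ e" if "e \<in> insert a A" for e
      using that x y assms(3)[OF x(1), of e] assms(3)[OF y(1), of e]
      by (auto intro: add_pos_nonneg add_nonneg_pos)
    ultimately show ?case by blast
  qed
qed

text \<open>Finitely many strict inequalities leave room for a common small step. This lets a point
  positive on \<open>A\<close> be perturbed without losing nonnegativity there.\<close>

lemma ex_small_multiple_le:
  fixes y d :: "'a \<Rightarrow> real"
  assumes "finite A" "\<And>a. a \<in> A \<Longrightarrow> 0 < y a"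
  shows "\<exists>\<epsilon>>0. \<epsilon> < 1 \<and> (\<forall>a \<in> A. \<epsilon> * d a \<le> y a)"
  using assms
proof (induction A)
  case empty
  show ?case by (rule exI[of _ "1/2"]) simp
next
  case (insert a A)
  then obtain \<epsilon> where \<epsilon>: "0 < \<epsilon>" "\<epsilon> < 1" "\<forall>b \<in> A. \<epsilon> * d b \<le> y b" by blast
  \<comment> \<open>The summand 1 keeps the denominator positive when \<open>d a = 0\<close>.
    Passing to a smaller step preserves the earlier inequalities.\<close>
  let ?\<delta> = "min \<epsilon> (y a / (\<bar>d a\<bar> + 1))"
  have \<delta>: "0 < ?\<delta>" "?\<delta> \<le> \<epsilon>" using \<epsilon> insert.prems[of a] by auto
  have "?\<delta> * d b \<le> y b" if "b \<in> A" for b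
  proof (cases "d b \<le> 0")
    case True
    with \<delta> insert.prems[of b] that show ?thesis
      by (meson insertI2 less_imp_le mult_nonneg_nonpos order_trans)
  next
    case False
    then have "?\<delta> * d b \<le> \<epsilon> * d b" using \<delta> by (intro mult_right_mono) auto
    with \<epsilon> that show ?thesis by fastforce
  qed
  moreover have "?\<delta> * d a \<le> y a"
  proof -
    have "?\<delta> * d a \<le> ?\<delta> * (\<bar>d a\<bar> + 1)" using \<delta>(1) by (intro mult_left_mono) auto
    also have "\<dots> \<le> y a / (\<bar>d a\<bar> + 1) * (\<bar>d a\<bar> + 1)" by (intro mult_right_mono) auto
    also have "\<dots> = y a" by (simp add: field_simps abs_if)
    finally show ?thesis .
  qed
  ultimately show ?case using \<delta> \<epsilon>(2) by (intro exI[of _ ?\<delta>]) auto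
qed

section \<open>Routes\<close>

text \<open>Distinct tails leave only one arc of the set that can start at \<open>u\<close>;
  following it from vertex to vertex reconstructs the walk from its arc set.\<close>

lemma (in pre_digraph) cas_eqI:
  assumes "cas u p w" "cas u q w" "set p = set q"
    and "distinct (map (tail G) p)" "distinct (map (tail G) q)"
  shows "p = q"
  using assms
proof (induction p arbitrary: u q)
  case Nil
  then show ?case by simp
next
  case (Cons e p)
  then obtain f q' where q: "q = f # q'" by (cases q) auto
  have "f \<in> set (e # p)" using Cons.prems(3) q by simp
  moreover have "tail G f = tail G e" using Cons.prems q by simp
  ultimately have "f = e" using Cons.prems(4) by (metis distinct.simps(2) imageI list.simps(9) list.set_map set_ConsD)
  moreover have "e \<notin> set p" "f \<notin> set q'" using Cons.prems(4,5) q by auto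
  ultimately have "set p = set q'" using Cons.prems(3) q by auto
  then show ?case using Cons.IH[of "head G e" q'] Cons.prems q \<open>f = e\<close> by auto
qed

text \<open>The sum telescopes: the arrival at each intermediate vertex cancels against the next
  departure. For routes this becomes flow conservation.\<close>

lemma (in pre_digraph) cas_balance:
  assumes "cas u p w"
  shows "(\<Sum>e\<leftarrow>p. of_bool (tail G e = v) - of_bool (head G e = v))
    = (of_bool (u = v) - of_bool (w = v) :: real)"
  using assms by (induction u p w rule: cas.induct) auto

context st_dag
begin

text \<open>A repeated vertex would give a nonempty closed walk, contradicting acyclicity. Hence
  concatenated walks from \<open>s\<close> to \<open>t\<close> are routes automatically.\<close>

lemma routes_awalk_iff: "R \<in> routes G s t \<longleftrightarrow> awalk s R t"
proof
  assume R: "awalk s R t"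
  have "distinct (awalk_verts s R)"
  proof (rule ccontr)
    assume "\<not> distinct (awalk_verts s R)"
    then obtain w c where "awalk w c w" "c \<noteq> []"
      using awalk_not_distinct_decomp[OF R] by auto
    then show False using reachable1_awalkI acyclic_arcs by (auto simp: acyclic_def)
  qed
  with R show "R \<in> routes G s t" by (simp add: routes_def apath_def)
qed (simp add: routes_def apath_def)

lemma distinct_tails_route:
  assumes "R \<in> routes G s t"
  shows "distinct (map (tail G) R)"
  using assms by (auto simp: routes_def apath_def awalk_verts_conv split: if_splits)

lemma route_nonempty: "R \<in> routes G s t \<Longrightarrow> R \<noteq> []"
  using source_neq_sink by (auto simp: routes_def apath_Nil_iff)

lemma route_eqI:
  assumes "P \<in> routes G s t" "Q \<in> routes G s t" "set P = set Q"
  shows "P = Q"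
  using assms distinct_tails_route by (intro cas_eqI[of s P t Q]) (auto simp: routes_def apath_def)

lemma in_arcs_empty_iff: "v \<in> verts G \<Longrightarrow> in_arcs G v = {} \<longleftrightarrow> v = s"
  using unique_source finite_in_arcs by (auto simp: in_degree_def)

lemma out_arcs_empty_iff: "v \<in> verts G \<Longrightarrow> out_arcs G v = {} \<longleftrightarrow> v = t"
  using unique_sink finite_out_arcs by (auto simp: out_degree_def)

lemma source_in_verts: "s \<in> verts G" and sink_in_verts: "t \<in> verts G"
  using unique_source unique_sink by auto

lemma head_neq_source: "e \<in> arcs G \<Longrightarrow> head G e \<noteq> s"
  using in_arcs_empty_iff[OF source_in_verts] by auto

lemma tail_neq_sink: "e \<in> arcs G \<Longrightarrow> tail G e \<noteq> t"
  using out_arcs_empty_iff[OF sink_in_verts] by auto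

lemma finite_arcs_ends: "finite (arcs_ends G)"
  by (simp add: arcs_ends_def)

text \<open>At an inner vertex the outgoing arcs are neither empty nor just \<open>e\<close>, so one
  can always step on along another arc; acyclicity ends the walk at \<open>t\<close>. The start
  \<open>s\<close> is excluded because idleness concerns inner vertices only: \<open>e\<close> may
  be the sole arc leaving \<open>s\<close>. No arc enters \<open>s\<close>, so the exclusion
  persists along the walk.\<close>

lemma ex_awalk_to_sink_avoiding:
  assumes "\<And>f. f \<in> arcs G \<Longrightarrow> \<not> idle G s t f" and "v \<in> verts G" "v \<noteq> s"
  shows "\<exists>p. awalk v p t \<and> e \<notin> set p"
  using assms(2,3)
proof (induction v rule: wf_induct_rule[OF finite_acyclic_wf_converse[OF finite_arcs_ends acyclic_arcs]])
  case (1 v)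
  show ?case
  proof (cases "v = t")
    case True
    then have "awalk v [] t" using 1 by (simp add: awalk_Nil_iff)
    then show ?thesis by fastforce
  next
    case False
    have "out_arcs G v \<noteq> {}" using out_arcs_empty_iff 1 False by simp
    moreover have "out_arcs G v \<noteq> {e}"
    proof
      assume e: "out_arcs G v = {e}"
      then have "e \<in> arcs G" by (metis in_out_arcs_conv singletonI)
      with assms(1)[of e] 1 False e show False by (auto simp: idle_def inner_verts_def)
    qed
    ultimately obtain g where g: "g \<in> arcs G" "tail G g = v" "g \<noteq> e"
      by (metis in_out_arcs_conv is_singletonI' is_singleton_the_elem singletonD singletonI)
    then have "(head G g, v) \<in> (arcs_ends G)\<inverse>"
      by (auto simp: arcs_ends_def arc_to_ends_def)
    then obtain p where "awalk (head G g) p t" "e \<notin> set p"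
      using 1 g head_neq_source by force
    with g have "awalk v (g # p) t" "e \<notin> set (g # p)"
      by (auto simp: awalk_Cons_iff)
    then show ?thesis by blast
  qed
qed

text \<open>The mirror image: step backwards along incoming arcs other than \<open>e\<close>, by
  induction over predecessors.\<close>

lemma ex_awalk_from_source_avoiding:
  assumes "\<And>f. f \<in> arcs G \<Longrightarrow> \<not> idle G s t f" and "v \<in> verts G" "v \<noteq> t"
  shows "\<exists>p. awalk s p v \<and> e \<notin> set p"
  using assms(2,3)
proof (induction v rule: wf_induct_rule[OF finite_acyclic_wf[OF finite_arcs_ends acyclic_arcs]])
  case (1 v)
  show ?case
  proof (cases "v = s")
    case True
    then have "awalk s [] v" using 1 by (simp add: awalk_Nil_iff)
    then show ?thesis by fastforce
  next
    case False
    have "in_arcs G v \<noteq> {}" using in_arcs_empty_iff 1 False by simp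
    moreover have "in_arcs G v \<noteq> {e}"
    proof
      assume e: "in_arcs G v = {e}"
      then have "e \<in> arcs G" by (metis in_in_arcs_conv singletonI)
      with assms(1)[of e] 1 False e show False by (auto simp: idle_def inner_verts_def)
    qed
    ultimately obtain g where g: "g \<in> arcs G" "head G g = v" "g \<noteq> e"
      by (metis in_in_arcs_conv is_singletonI' is_singleton_the_elem singletonD singletonI)
    then have "(tail G g, v) \<in> arcs_ends G"
      by (auto simp: arcs_ends_def arc_to_ends_def)
    then obtain p where p: "awalk s p (tail G g)" "e \<notin> set p"
      using 1 g tail_neq_sink by force
    moreover have "awalk (tail G g) [g] v"
      using g by (auto simp: awalk_Cons_iff awalk_Nil_iff)
    ultimately have "awalk s (p @ [g]) v" "e \<notin> set (p @ [g])"
      using g(3) by (auto intro: awalk_appendI simp del: awalk_append_iff)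
    then show ?thesis by blast
  qed
qed

text \<open>Supplies, for each coordinate \<open>f\<close> other than \<open>e\<close>, a point of
  the face \<open>x $ e = 0\<close> that is positive at \<open>f\<close>.\<close>

lemma ex_route_through_avoiding:
  assumes "\<And>f. f \<in> arcs G \<Longrightarrow> \<not> idle G s t f" and "f \<in> arcs G" "f \<noteq> e"
  shows "\<exists>R \<in> routes G s t. f \<in> set R \<and> e \<notin> set R"
proof -
  obtain p where p: "awalk s p (tail G f)" "e \<notin> set p"
    using ex_awalk_from_source_avoiding[OF assms(1)] assms(2) tail_neq_sink by force
  obtain q where q: "awalk (head G f) q t" "e \<notin> set q"
    using ex_awalk_to_sink_avoiding[OF assms(1)] assms(2) head_neq_source by force
  have "awalk (tail G f) (f # q) t"
    using q assms(2) by (simp add: awalk_Cons_iff)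
  with p(1) have "p @ f # q \<in> routes G s t"
    unfolding routes_awalk_iff by (rule awalk_appendI)
  with p q assms(3) show ?thesis by (intro bexI[of _ "p @ f # q"]) auto
qed

end

section \<open>The flow polytope\<close>

text \<open>Dropping nonnegativity leaves an affine space. Affine combinations with negative
  coefficients stay in it, so only signs remain to be checked for membership in the
  polytope.\<close>

definition flow_space :: "('v, 'e::finite) pre_digraph \<Rightarrow> 'v \<Rightarrow> 'v \<Rightarrow> (real ^ 'e) set" where
  "flow_space G s t = {x.
     (\<forall>v \<in> inner_verts G s t. (\<Sum>e \<in> in_arcs G v. x $ e) = (\<Sum>e \<in> out_arcs G v. x $ e))
     \<and> (\<Sum>e \<in> out_arcs G s. x $ e) = 1}"

lemma flow_polytope_iff: "x \<in> flow_polytope G s t \<longleftrightarrow> (\<forall>e. 0 \<le> x $ e) \<and> x \<in> flow_space G s t"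
  by (simp add: flow_polytope_def flow_space_def)

lemma affine_flow_space: "affine (flow_space G s t)"
  by (auto simp: affine_def flow_space_def sum.distrib simp flip: sum_distrib_left)

lemma convex_flow_polytope: "convex (flow_polytope G s t)"
proof -
  have "flow_polytope G s t = {x. \<forall>e. 0 \<le> x $ e} \<inter> flow_space G s t"
    by (auto simp: flow_polytope_iff)
  moreover have "convex {x :: real ^ 'a. \<forall>e. 0 \<le> x $ e}"
    by (auto simp: convex_def)
  ultimately show ?thesis
    using affine_flow_space affine_imp_convex convex_Int by metis
qed

lemma route_vec_nth [simp]: "route_vec R $ e = (if e \<in> set R then 1 else 0)"
  by (simp add: route_vec_def)

lemma route_vec_eq_iff: "route_vec P = route_vec Q \<longleftrightarrow> set P = set Q"
  by (auto simp: vec_eq_iff split: if_splits)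

lemma route_vec_in_flow_polytope:
  assumes "st_dag G s t" "R \<in> routes G s t"
  shows "route_vec R \<in> flow_polytope G s t"
proof -
  interpret st_dag G s t by fact
  have R: "cas s R t" "set R \<subseteq> arcs G" "distinct R"
    using assms(2) distinct_tails_route[OF assms(2)] by (auto simp: routes_def apath_def distinct_map)
  \<comment> \<open>Here \<open>f\<close> stands for \<open>tail G\<close> or \<open>head G\<close>,
    which turns outflow and inflow into counts over the arcs of \<open>R\<close>.\<close>
  have sum_eq: "(\<Sum>e \<in> {e \<in> arcs G. f e = v}. route_vec R $ e) = (\<Sum>e \<in> set R. of_bool (f e = v))"
    for f and v :: 'a
  proof -
    have "{e \<in> arcs G. f e = v} \<inter> set R = set R \<inter> {e. f e = v}" using R by auto
    then show ?thesis by (simp add: sum.If_cases of_bool_def)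
  qed
  have balance: "(\<Sum>e \<in> out_arcs G v. route_vec R $ e) - (\<Sum>e \<in> in_arcs G v. route_vec R $ e)
      = of_bool (s = v) - of_bool (t = v)" for v
    using cas_balance[OF R(1), of v] R(3)
    unfolding out_arcs_def in_arcs_def sum_eq
    by (simp add: sum_list_distinct_conv_sum_set sum_subtractf)
  have "in_arcs G s = {}" using in_arcs_empty_iff source_in_verts by blast
  then have "(\<Sum>e \<in> out_arcs G s. route_vec R $ e) = 1"
    using balance[of s] source_neq_sink by simp
  moreover have "(\<Sum>e \<in> in_arcs G v. route_vec R $ e) = (\<Sum>e \<in> out_arcs G v. route_vec R $ e)"
    if "v \<in> inner_verts G s t" for v
    using balance[of v] that by (auto simp: inner_verts_def)
  ultimately show ?thesis unfolding flow_polytope_iff flow_space_def by simp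
qed

text \<open>The hull lies in the unit cube, and a 0/1-point of the cube is in no open segment of it.
  Thus the vertices of a simplex can be read off from the simplex as a set.\<close>

lemma extreme_points_of_hull_route_vec:
  "{x. x extreme_point_of (convex hull (route_vec ` C))} = route_vec ` C"
proof
  show "{x. x extreme_point_of (convex hull (route_vec ` C))} \<subseteq> route_vec ` C"
    by (rule extreme_points_of_convex_hull)
next
  let ?Q = "{x :: real ^ 'a. \<forall>e. 0 \<le> x $ e \<and> x $ e \<le> 1}"
  have "convex ?Q"
    by (auto simp: convex_def intro: convex_bound_le)
  then have hull: "convex hull (route_vec ` C) \<subseteq> ?Q"
    by (intro hull_minimal) auto
  have notin: "route_vec P \<notin> open_segment a b" if "a \<in> ?Q" "b \<in> ?Q" for P a b
  proof
    assume "route_vec P \<in> open_segment a b"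
    then obtain u where u: "a \<noteq> b" "0 < u" "u < 1" "route_vec P = (1 - u) *\<^sub>R a + u *\<^sub>R b"
      by (auto simp: in_segment)
    have "a $ e = b $ e" for e
    proof -
      have eq: "route_vec P $ e = (1 - u) * a $ e + u * b $ e" by (simp only: u(4)) simp
      have ab: "0 \<le> a $ e" "a $ e \<le> 1" "0 \<le> b $ e" "b $ e \<le> 1" using that by auto
      show ?thesis
      \<comment> \<open>At a coordinate 1 the distances of \<open>a\<close> and \<open>b\<close>
        from 1, and at a coordinate 0 their values, are nonnegative with vanishing weighted sum, so
        both are zero.\<close>
      proof (cases "e \<in> set P")
        case True
        then have "(1 - u) * (1 - a $ e) + u * (1 - b $ e) = 0" using eq by (simp add: algebra_simps)
        then show ?thesis using u ab by (simp add: add_nonneg_eq_0_iff)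
      next
        case False
        then have "(1 - u) * a $ e + u * b $ e = 0" using eq by simp
        then show ?thesis using u ab by (simp add: add_nonneg_eq_0_iff)
      qed
    qed
    with u(1) show False by (simp add: vec_eq_iff)
  qed
  show "route_vec ` C \<subseteq> {x. x extreme_point_of (convex hull (route_vec ` C))}"
  proof safe
    fix P assume "P \<in> C"
    then show "route_vec P extreme_point_of (convex hull (route_vec ` C))"
      unfolding extreme_point_of_def using notin subsetD[OF hull] by (simp add: hull_inc)
  qed
qed

lemma face_avoiding_route_vanishes:
  assumes "st_dag G s t" "R \<in> routes G s t"
    and face: "F face_of flow_polytope G s t" and R: "route_vec R \<notin> F"
  shows "\<exists>e \<in> set R. \<forall>x \<in> F. x $ e = 0"
proof (cases "F = {}")
  \<comment> \<open>For the empty face, which \<open>facet_in\<close> admits, any arc of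
    \<open>R\<close> will do, and a route has at least one since
    \<open>s \<noteq> t\<close>.\<close>
  case True
  then show ?thesis using st_dag.route_nonempty[OF assms(1,2)] by (auto simp: ex_in_conv)
next
  case False
  show ?thesis
  proof (rule ccontr)
    let ?P = "flow_polytope G s t"
    have FP: "F \<subseteq> ?P" using face by (rule face_of_imp_subset)
    assume "\<not> ?thesis"
    then have "\<exists>x \<in> F. 0 < x $ e" if "e \<in> set R" for e
      using that FP by (fastforce simp: flow_polytope_iff order_less_le)
    then obtain x where x: "x \<in> F" "\<forall>e \<in> set R. 0 < x $ e"
      using convex_ex_positive_on[of F "set R"] face_of_imp_convex[OF face] False FP
      by (fastforce simp: flow_polytope_iff)
    obtain \<epsilon> where \<epsilon>: "0 < \<epsilon>" "\<epsilon> < 1" "\<forall>e \<in> set R. \<epsilon> * 1 \<le> x $ e"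
      using ex_small_multiple_le[of "set R" "\<lambda>e. x $ e" "\<lambda>_. 1"] x by auto
    \<comment> \<open>The point slightly beyond \<open>x\<close> on the line from
      \<open>route_vec R\<close> through \<open>x\<close>. It stays nonnegative because
      \<open>x\<close> is at least \<open>\<epsilon>\<close> on all arcs of \<open>R\<close>; then
      \<open>x\<close> lies strictly between \<open>?y\<close> and \<open>route_vec R\<close>, and
      the face property would put \<open>route_vec R\<close> into \<open>F\<close>.\<close>
    let ?y = "(1 / (1 - \<epsilon>)) *\<^sub>R x + (- \<epsilon> / (1 - \<epsilon>)) *\<^sub>R route_vec R"
    have RP: "route_vec R \<in> ?P" using assms(1,2) by (rule route_vec_in_flow_polytope)
    have "1 / (1 - \<epsilon>) + - \<epsilon> / (1 - \<epsilon>) = 1" using \<epsilon> by (simp add: field_simps)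
    then have "?y \<in> flow_space G s t"
      using x FP RP by (intro mem_affine affine_flow_space) (auto simp: flow_polytope_iff)
    moreover have "0 \<le> ?y $ e" for e
    proof -
      have "?y $ e = (x $ e - \<epsilon> * route_vec R $ e) / (1 - \<epsilon>)"
        by (simp add: diff_divide_distrib)
      moreover have "0 \<le> x $ e - \<epsilon> * route_vec R $ e"
        using \<epsilon>(3) x(1) FP by (auto simp: flow_polytope_iff)
      ultimately show ?thesis using \<epsilon>(2) by simp
    qed
    ultimately have y: "?y \<in> ?P" by (simp add: flow_polytope_iff)
    have eq: "x = (1 - \<epsilon>) *\<^sub>R ?y + \<epsilon> *\<^sub>R route_vec R"
      using \<epsilon> by (simp add: scaleR_diff_right)
    have "?y \<noteq> route_vec R"
    proof
      assume "?y = route_vec R"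
      then have "x = route_vec R" using eq by (simp add: algebra_simps)
      then show False using x R by simp
    qed
    then have "x \<in> open_segment ?y (route_vec R)"
      using eq \<epsilon> unfolding in_segment by blast
    then show False using face x(1) y RP R unfolding face_of_def by blast
  qed
qed

text \<open>The codimension is bounded from both sides: a proper face has smaller dimension, and
  adjoining a single point raises the dimension by at most one.\<close>

lemma coordinate_facet:
  fixes G :: "('v, 'e::finite) pre_digraph"
  assumes "st_dag G s t" and arcs: "arcs G = UNIV"
    and idle: "\<And>e. e \<in> arcs G \<Longrightarrow> \<not> idle G s t e"
    and R: "R \<in> routes G s t" "e \<in> set R"
  shows "facet_in {x \<in> flow_polytope G s t. x $ e = 0} (flow_polytope G s t)"
proof -
  interpret st_dag G s t by fact
  let ?P = "flow_polytope G s t" and ?F = "{x \<in> flow_polytope G s t. x $ e = 0}"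
  let ?z = "route_vec R"
  have z: "?z \<in> ?P" by (rule route_vec_in_flow_polytope) fact+
  have face: "?F face_of ?P"
    unfolding face_of_def
  proof (intro conjI ballI impI)
    show "convex ?F"
      using convex_flow_polytope[of G s t] by (auto simp: convex_def)
  next
    fix a b x assume ab: "a \<in> ?P" "b \<in> ?P" and x: "x \<in> ?F" "x \<in> open_segment a b"
    then obtain u where u: "0 < u" "u < 1" "x = (1 - u) *\<^sub>R a + u *\<^sub>R b"
      by (auto simp: in_segment)
    then have "(1 - u) * a $ e + u * b $ e = 0" using x(1) by simp
    then have "a $ e = 0 \<and> b $ e = 0"
      using u ab by (simp add: add_nonneg_eq_0_iff flow_polytope_iff)
    then show "a \<in> ?F" "b \<in> ?F" using ab by auto
  qed auto
  have "?z \<notin> ?F" using R(2) by simp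
  then have "aff_dim ?F < aff_dim ?P"
    using z by (intro face_of_aff_dim_lt convex_flow_polytope face) blast
  moreover have "?P \<subseteq> affine hull (insert ?z ?F)"
  proof
    fix x assume x: "x \<in> ?P"
    show "x \<in> affine hull (insert ?z ?F)"
    proof (cases "\<exists>f. f \<noteq> e")
      \<comment> \<open>If \<open>e\<close> is the only arc, the polytope is the point
        \<open>?z\<close> and \<open>?F\<close> is empty, of dimension -1.\<close>
      case False
      then have UN: "UNIV = {e}" by auto
      have "out_arcs G s \<noteq> {}"
        using out_arcs_empty_iff source_in_verts source_neq_sink by blast
      then have "out_arcs G s = {e}" by (metis UN subset_UNIV subset_singletonD)
      then have "x $ e = 1" using x by (simp add: flow_polytope_def)
      then have "x = ?z" using R(2) False by (auto simp: vec_eq_iff)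
      then show ?thesis by (simp add: hull_inc)
    next
      case True
      have pos: "\<exists>x \<in> ?F. 0 < x $ f" if f: "f \<noteq> e" for f
      proof -
        obtain Q where "Q \<in> routes G s t" "f \<in> set Q" "e \<notin> set Q"
          using ex_route_through_avoiding[OF idle, of f e] f arcs by auto
        then show ?thesis
          using route_vec_in_flow_polytope[OF assms(1)] by (intro bexI[of _ "route_vec Q"]) auto
      qed
      have "\<exists>y \<in> ?F. \<forall>f \<in> - {e}. 0 < y $ f"
        by (rule convex_ex_positive_on)
          (use face_of_imp_convex[OF face] True pos in \<open>auto simp: flow_polytope_iff\<close>)
      then obtain y where y: "y \<in> ?F" "\<And>f. f \<noteq> e \<Longrightarrow> 0 < y $ f" by auto
      obtain \<epsilon> where \<epsilon>: "0 < \<epsilon>"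
        "\<And>f. f \<noteq> e \<Longrightarrow> \<epsilon> * (x $ e * ?z $ f + (1 - x $ e) * y $ f) \<le> y $ f"
        using ex_small_multiple_le[of "- {e}" "\<lambda>f. y $ f"
            "\<lambda>f. x $ e * ?z $ f + (1 - x $ e) * y $ f"] y(2) by auto
      \<comment> \<open>The point \<open>x - x $ e * ?z + x $ e * y\<close> satisfies the flow
        equations and vanishes at \<open>e\<close>, but may have negative coordinates.
        \<open>?w\<close> moves from \<open>y\<close> towards it by the fraction
        \<open>\<epsilon>\<close>; the bound on \<open>\<epsilon>\<close> controls exactly the
        subtracted terms, so \<open>?w\<close> is in \<open>?F\<close>.\<close>
      let ?w = "\<epsilon> *\<^sub>R x + (- \<epsilon> * x $ e) *\<^sub>R ?z + (1 - \<epsilon> * (1 - x $ e)) *\<^sub>R y"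
      have "?w \<in> flow_space G s t"
        using x y z by (intro mem_affine_3 affine_flow_space)
          (auto simp: flow_polytope_iff algebra_simps)
      moreover have "?w $ e = 0" using y(1) R(2) by simp
      moreover have "0 \<le> ?w $ f" if "f \<noteq> e" for f
      proof -
        have "0 \<le> \<epsilon> * x $ f" using x \<epsilon>(1) by (simp add: flow_polytope_iff)
        moreover have "?w $ f = \<epsilon> * x $ f
            + (y $ f - \<epsilon> * (x $ e * ?z $ f + (1 - x $ e) * y $ f))"
          by (simp add: algebra_simps)
        ultimately show ?thesis using \<epsilon>(2)[OF that] by linarith
      qed
      ultimately have w: "?w \<in> ?F"
        unfolding flow_polytope_iff mem_Collect_eq by (metis order_refl)
      \<comment> \<open>Solving the definition of \<open>?w\<close> for \<open>x\<close> gives an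
        affine combination of \<open>?w\<close>, \<open>?z\<close> and \<open>y\<close>.\<close>
      have "(1 / \<epsilon>) *\<^sub>R ?w + (x $ e) *\<^sub>R ?z + (1 - x $ e - 1 / \<epsilon>) *\<^sub>R y
          \<in> affine hull (insert ?z ?F)"
        by (rule mem_affine_3[OF affine_affine_hull hull_inc[OF insertI2[OF w]]
              hull_inc[OF insertI1] hull_inc[OF insertI2[OF y(1)]]]) simp
      moreover have "(1 / \<epsilon>) *\<^sub>R ?w + (x $ e) *\<^sub>R ?z + (1 - x $ e - 1 / \<epsilon>) *\<^sub>R y = x"
        using \<epsilon>(1) by (simp add: vec_eq_iff field_simps)
      ultimately show ?thesis by simp
    qed
  qed
  then have "aff_dim ?P \<le> aff_dim (insert ?z ?F)"
    by (metis aff_dim_affine_hull aff_dim_subset)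
  then have "aff_dim ?P \<le> aff_dim ?F + 1"
    by (auto simp: aff_dim_insert split: if_splits)
  ultimately show ?thesis using face by (simp add: facet_in_def)
qed

section \<open>The equatorial triangulation\<close>

text \<open>Reduces the global choice of a transversal to a separate condition for each route.
  Disjointness makes independent choices compatible: an arc chosen for \<open>R'\<close> that lies
  on \<open>R\<close> forces \<open>R' = R\<close>.\<close>

lemma transversal_avoided_iff:
  assumes "disjoint_family_on set \<R>"
  shows "(\<exists>U. transversal \<R> U \<and> (\<forall>P \<in> C. set P \<inter> U = {})) \<longleftrightarrow>
    (\<forall>R \<in> \<R>. \<exists>e \<in> set R. \<forall>P \<in> C. e \<notin> set P)"
proof
  assume "\<exists>U. transversal \<R> U \<and> (\<forall>P \<in> C. set P \<inter> U = {})"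
  then obtain U where U: "transversal \<R> U" "\<forall>P \<in> C. set P \<inter> U = {}"
    by blast
  show "\<forall>R \<in> \<R>. \<exists>e \<in> set R. \<forall>P \<in> C. e \<notin> set P"
  proof
    fix R assume "R \<in> \<R>"
    with U(1) have "\<exists>!e. e \<in> U \<and> e \<in> set R" by (simp add: transversal_def)
    then obtain e where "e \<in> U" "e \<in> set R" by (elim ex1E conjE)
    with U(2) show "\<exists>e \<in> set R. \<forall>P \<in> C. e \<notin> set P" by blast
  qed
next
  assume "\<forall>R \<in> \<R>. \<exists>e \<in> set R. \<forall>P \<in> C. e \<notin> set P"
  then obtain e where e: "\<And>R. R \<in> \<R> \<Longrightarrow> e R \<in> set R" "\<And>R P. R \<in> \<R> \<Longrightarrow> P \<in> C \<Longrightarrow> e R \<notin> set P"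
    by metis
  have "\<exists>!f. f \<in> e ` \<R> \<and> f \<in> set R" if "R \<in> \<R>" for R
  proof (rule ex1I[of _ "e R"])
    show "e R \<in> e ` \<R> \<and> e R \<in> set R" using that e(1) by blast
  next
    fix f assume "f \<in> e ` \<R> \<and> f \<in> set R"
    then obtain R' where R': "R' \<in> \<R>" "f = e R'" "f \<in> set R" by blast
    then have "R' = R" using e(1)[of R'] that assms unfolding disjoint_family_on_def by blast
    with R'(2) show "f = e R" by simp
  qed
  with e have "transversal \<R> (e ` \<R>) \<and> (\<forall>P \<in> C. set P \<inter> e ` \<R> = {})"
    unfolding transversal_def by blast
  then show "\<exists>U. transversal \<R> U \<and> (\<forall>P \<in> C. set P \<inter> U = {})" by blast
qed

text \<open>From left to right, each \<open>F R\<close> yields an arc of \<open>R\<close> that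
  vanishes on it and hence is used by no route of \<open>C\<close>. Conversely, the avoided arcs
  define coordinate facets, whose intersection is itself a member of the complex.\<close>

lemma hull_in_equatorial_complex_iff:
  fixes G :: "('v, 'e::finite) pre_digraph"
  assumes "st_dag G s t" "arcs G = UNIV" "\<And>e. e \<in> arcs G \<Longrightarrow> \<not> idle G s t e"
    and "\<R> \<subseteq> routes G s t" "C \<subseteq> routes G s t"
  shows "(\<exists>H \<in> equatorial_complex G s t \<R>. convex hull (route_vec ` C) \<subseteq> H) \<longleftrightarrow>
    (\<forall>R \<in> \<R>. \<exists>e \<in> set R. \<forall>P \<in> C. e \<notin> set P)" (is "?L \<longleftrightarrow> ?R")
proof
  assume ?L
  then obtain F where F: "\<And>R. R \<in> \<R> \<Longrightarrow> facet_in (F R) (flow_polytope G s t)"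
      "\<And>R. R \<in> \<R> \<Longrightarrow> route_vec R \<notin> F R"
    and sub: "convex hull (route_vec ` C) \<subseteq> (\<Inter>R \<in> \<R>. F R)"
    unfolding equatorial_complex_def using face_of_imp_subset by fastforce
  show ?R
  proof
    fix R assume R: "R \<in> \<R>"
    then obtain e where e: "e \<in> set R" "\<forall>x \<in> F R. x $ e = 0"
      using face_avoiding_route_vanishes[OF assms(1), of R "F R"] F assms(4)
      by (auto simp: facet_in_def)
    have "e \<notin> set P" if "P \<in> C" for P
    proof -
      have "route_vec P \<in> F R" using sub R that by (meson INT_E hull_inc imageI subsetD)
      with e(2) have "route_vec P $ e = 0" by blast
      then show ?thesis by (simp split: if_splits)
    qed
    with e(1) show "\<exists>e \<in> set R. \<forall>P \<in> C. e \<notin> set P" by blast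
  qed
next
  assume ?R
  then obtain e where e: "\<And>R. R \<in> \<R> \<Longrightarrow> e R \<in> set R" "\<And>R P. R \<in> \<R> \<Longrightarrow> P \<in> C \<Longrightarrow> e R \<notin> set P"
    by metis
  define F where "F R = {x \<in> flow_polytope G s t. x $ e R = 0}" for R
  have F: "facet_in (F R) (flow_polytope G s t)" "route_vec R \<notin> F R" if "R \<in> \<R>" for R
    using coordinate_facet[OF assms(1-3)] e(1) that assms(4) by (auto simp: F_def)
  have conv: "convex (\<Inter>R \<in> \<R>. F R)"
    using F(1) face_of_imp_convex unfolding facet_in_def by (blast intro: convex_INT)
  then have "(\<Inter>R \<in> \<R>. F R) \<in> equatorial_complex G s t \<R>"
    unfolding equatorial_complex_def using F face_of_refl by blast
  moreover have "convex hull (route_vec ` C) \<subseteq> (\<Inter>R \<in> \<R>. F R)"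
    using assms(5) e(2) route_vec_in_flow_polytope[OF assms(1)]
    by (intro hull_minimal conv) (auto simp: F_def)
  ultimately show ?L by blast
qed

theorem theorem4p13:
  fixes G :: "('v, 'e::finite) pre_digraph" and s t :: 'v
    and \<R> :: "'e awalk set" and r :: "'e awalk rel" and C :: "'e awalk set"
  assumes "st_dag G s t"
    and "arcs G = UNIV"
    and "\<And>e. e \<in> arcs G \<Longrightarrow> \<not> idle G s t e"
    and "degree_equality G s t"
    and "route_decomposition G s t \<R>"
    and "linear_order_on \<R> r"
    and "C \<subseteq> routes G s t"
  shows "(\<exists>\<sigma> \<in> equatorial_triangulation G s t \<R> r. {x. x extreme_point_of \<sigma>} = route_vec ` C) \<longleftrightarrow>
    (is_clique G s t (route_framing G \<R> r) C \<and>
     (\<exists>U. transversal \<R> U \<and> (\<forall>P \<in> C. set P \<inter> U = {})))"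
proof -
  let ?\<F> = "route_framing G \<R> r"
  \<comment> \<open>A simplex is given only as the hull of some clique \<open>D\<close>; injectivity
    of \<open>route_vec\<close> on routes recovers \<open>D\<close> from its vertices.\<close>
  have C_eq: "D = C" if "is_clique G s t ?\<F> D" "route_vec ` D = route_vec ` C" for D
  proof -
    have "inj_on route_vec (routes G s t)"
      using st_dag.route_eqI[OF assms(1)] by (auto simp: inj_on_def route_vec_eq_iff)
    then show ?thesis
      using that assms(7) by (simp add: is_clique_def inj_on_image_eq_iff)
  qed
  have "(\<exists>\<sigma> \<in> equatorial_triangulation G s t \<R> r. {x. x extreme_point_of \<sigma>} = route_vec ` C) \<longleftrightarrow>
      (\<exists>D. is_clique G s t ?\<F> D \<and> route_vec ` D = route_vec ` C \<and>
        (\<exists>H \<in> equatorial_complex G s t \<R>. convex hull (route_vec ` D) \<subseteq> H))"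
    (is "?L \<longleftrightarrow> ?M")
  proof
    assume ?L
    then show ?M
      unfolding equatorial_triangulation_def restrict_complex_def dkk_triangulation_def
      by (auto simp: extreme_points_of_hull_route_vec) metis
  next
    assume ?M
    then obtain D where D: "is_clique G s t ?\<F> D" "route_vec ` D = route_vec ` C"
      "\<exists>H \<in> equatorial_complex G s t \<R>. convex hull (route_vec ` D) \<subseteq> H"
      by blast
    then have "convex hull (route_vec ` D) \<in> equatorial_triangulation G s t \<R> r"
      unfolding equatorial_triangulation_def restrict_complex_def dkk_triangulation_def by blast
    with D(2) show ?L by (metis extreme_points_of_hull_route_vec)
  qed
  also have "\<dots> \<longleftrightarrow> is_clique G s t ?\<F> C \<and>
      (\<exists>H \<in> equatorial_complex G s t \<R>. convex hull (route_vec ` C) \<subseteq> H)"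
    using C_eq by blast
  also have "\<dots> \<longleftrightarrow> is_clique G s t ?\<F> C \<and> (\<exists>U. transversal \<R> U \<and> (\<forall>P \<in> C. set P \<inter> U = {}))"
    using assms(5) hull_in_equatorial_complex_iff[OF assms(1-3) _ assms(7)]
    by (simp add: transversal_avoided_iff route_decomposition_def)
  finally show ?thesis .
qed

end
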